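(* Let $n,m$ be positive integers with $n \le m \le n+5$ and $m \ge 7$. Then \[Z_{(1)}(P_n \Box P_m) \le m,\] where $P_n \Box P_m$ is the Cartesian product of the paths on $n$ and $m$ vertices.
   Context: Let $G=(V,E)$ be a finite simple graph. Color-change rule (zero forcing): given a set of colored vertices, a colored vertex with exactly one uncolored neighbor colors ("forces") that neighbor. Leaks: for a set $L\subseteq V$, placing a leak on each $v\in L$ means attaching to $v$ one new pendant vertex (adjacent only to $v$) which is never initially colored; consequently no vertex of $L$ can ever force a vertex of $V$. A set $S\subseteq V$ is an $\ell$-forcing set if for every $L\subseteq V$ with $|L|\le \ell$, starting with exactly the vertices of $S$ colored and repeatedly applying the color-change rule in the graph with leaks on $L$, every vertex of $V$ eventually becomes colored. $Z_{(\ell)}(G)$ is the minimum size of an $\ell$-forcing set. The Cartesian product $G\Box H$ has vertex set $V(G)\times V(H)$, with $(x,y)\sim(x',y')$ iff ($x=x'$ and $y\sim y'$ in $H$) or ($y=y'$ and $x\sim x'$ in $G$). *)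

theory Defs
  imports "Graph_Theory.Pair_Digraph"
begin

text \<open>
  A finite simple graph is a \<open>pair_graph\<close>: a finite, loop-free, symmetric digraph
  without parallel arcs, where the edge joining \<open>u\<close> and \<open>v\<close> is the pair of arcs
  \<open>(u, v)\<close> and \<open>(v, u)\<close>.
\<close>

definition path_graph :: "nat \<Rightarrow> nat pair_pre_digraph" where
  "path_graph n =
    \<lparr> pverts = {1..n},
      parcs = {(i, j). i \<in> {1..n} \<and> j \<in> {1..n} \<and> (j = i + 1 \<or> i = j + 1)} \<rparr>"

definition cartesian_product ::
    "'a pair_pre_digraph \<Rightarrow> 'b pair_pre_digraph \<Rightarrow> ('a \<times> 'b) pair_pre_digraph"
    (infixr \<open>\<box>\<close> 80) where
  "G \<box> H =
    \<lparr> pverts = pverts G \<times> pverts H,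
      parcs = {((x, y), (x', y')).
        x \<in> pverts G \<and> x' \<in> pverts G \<and> y \<in> pverts H \<and> y' \<in> pverts H \<and>
        (x = x' \<and> (y, y') \<in> parcs H \<or> y = y' \<and> (x, x') \<in> parcs G)} \<rparr>"

definition color_change :: "'a pair_pre_digraph \<Rightarrow> 'a set \<Rightarrow> 'a set \<Rightarrow> bool" where
  "color_change G B B' \<longleftrightarrow>
    (\<exists>u \<in> B. \<exists>w. {v. (u, v) \<in> parcs G \<and> v \<notin> B} = {w} \<and> B' = insert w B)"

text \<open>
  The graph with leaks on \<open>L\<close>: the original vertices are tagged \<open>Inl\<close>, and
  \<open>Inr v\<close> is the pendant vertex attached to \<open>v \<in> L\<close>.
\<close>

definition add_leaks :: "'a pair_pre_digraph \<Rightarrow> 'a set \<Rightarrow> ('a + 'a) pair_pre_digraph" where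
  "add_leaks G L =
    \<lparr> pverts = Inl ` pverts G \<union> Inr ` L,
      parcs = {(Inl u, Inl v) | u v. (u, v) \<in> parcs G}
        \<union> {(Inl v, Inr v) | v. v \<in> L} \<union> {(Inr v, Inl v) | v. v \<in> L} \<rparr>"

text \<open>
  A vertex that can force retains its unique uncolored neighbor until that neighbor is
  colored, so maximal sequences of color changes all end in the same coloring; it therefore
  suffices that some sequence colors every vertex of \<open>G\<close>.
\<close>

definition leaky_forcing_set :: "nat \<Rightarrow> 'a pair_pre_digraph \<Rightarrow> 'a set \<Rightarrow> bool" where
  "leaky_forcing_set l G S \<longleftrightarrow> S \<subseteq> pverts G \<and>
    (\<forall>L. L \<subseteq> pverts G \<and> card L \<le> l \<longrightarrow>
      (\<exists>B. (color_change (add_leaks G L))\<^sup>*\<^sup>* (Inl ` S) B \<and> Inl ` pverts G \<subseteq> B))"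

definition leaky_forcing_number :: "nat \<Rightarrow> 'a pair_pre_digraph \<Rightarrow> nat" where
  "leaky_forcing_number l G = (LEAST k. \<exists>S. leaky_forcing_set l G S \<and> card S = k)"


lemma pair_graph_path_graph: "pair_graph (path_graph n)"
proof -
  have "finite (parcs (path_graph n))"
    by (rule finite_subset[of _ "{1..n} \<times> {1..n}"]) (auto simp: path_graph_def)
  then show ?thesis
    by unfold_locales (auto simp: path_graph_def symmetric_def intro!: symI)
qed

lemma pair_graph_cartesian_product:
  assumes "pair_graph G" "pair_graph H"
  shows "pair_graph (G \<box> H)"
proof -
  interpret G: pair_graph G by fact
  interpret H: pair_graph H by fact
  have "finite (parcs (G \<box> H))"
    by (rule finite_subset[of _ "(pverts G \<times> pverts H) \<times> (pverts G \<times> pverts H)"])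
      (auto simp: cartesian_product_def G.pair_finite_verts H.pair_finite_verts)
  then show ?thesis
    by unfold_locales
      (auto simp: cartesian_product_def symmetric_def G.pair_finite_verts H.pair_finite_verts
        dest: G.no_loops' H.no_loops' G.arcs_symmetric H.arcs_symmetric intro!: symI)
qed

lemma pair_graph_add_leaks:
  assumes "pair_graph G" "L \<subseteq> pverts G"
  shows "pair_graph (add_leaks G L)"
proof -
  interpret G: pair_graph G by fact
  have L: "finite L" using assms(2) G.pair_finite_verts by (rule finite_subset)
  have fin: "finite (pverts (add_leaks G L))"
    using L G.pair_finite_verts by (simp add: add_leaks_def)
  have "parcs (add_leaks G L) \<subseteq> pverts (add_leaks G L) \<times> pverts (add_leaks G L)"
    using assms(2) by (auto simp: add_leaks_def dest: G.in_arcsD1 G.in_arcsD2)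
  then have "finite (parcs (add_leaks G L))"
    using fin by (meson finite_SigmaI finite_subset)
  then show ?thesis
    using fin assms(2)
    by unfold_locales
      (auto simp: add_leaks_def symmetric_def
        dest: G.in_arcsD1 G.in_arcsD2 G.no_loops' G.arcs_symmetric intro!: symI)
qed

text \<open>The set whose minimum defines \<open>leaky_forcing_number\<close> is never empty.\<close>

lemma leaky_forcing_set_pverts: "leaky_forcing_set l G (pverts G)"
  unfolding leaky_forcing_set_def by blast

end

theory Submission
  imports Defs
begin

text \<open>
  Color a bar of consecutive vertices in the middle row, leaving equally many columns free on
  both sides as there are rows below it, together with two adjacent columns (the stem) below the
  left end of the bar; this uses exactly \<open>m\<close> vertices. The stem forces everything below the bar,
  and from there a cone on either side, which meets the bottom corner of the grid.
  The front is reflected there, climbs the side wall to the top corner, is reflected again and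
  fills the whole side. A leak disturbs only one of the two sides, or, if it lies on or below the
  bar, neither the left side nor the part above the bar; the filled columns sweep up to the leak and
  past it in two cones, one of which reaches the opposite wall and is reflected as before.
\<close>

section \<open>The forcing rule at a point of the integer plane\<close>

text \<open>
  Here \<open>c x y\<close> says that the point in column \<open>x\<close> and row \<open>y\<close> is colored. Points outside the
  grid count as colored, so a vertex on the boundary needs no special treatment.
\<close>

definition force_at :: "(int \<Rightarrow> int \<Rightarrow> bool) \<Rightarrow> int \<Rightarrow> int \<Rightarrow> bool" where
  "force_at c x y \<longleftrightarrow> (c x y \<longrightarrow>
     (c (x - 1) y \<and> c (x + 1) y \<and> c x (y - 1) \<longrightarrow> c x (y + 1)) \<and>
     (c (x - 1) y \<and> c (x + 1) y \<and> c x (y + 1) \<longrightarrow> c x (y - 1)) \<and>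
     (c (x - 1) y \<and> c x (y - 1) \<and> c x (y + 1) \<longrightarrow> c (x + 1) y) \<and>
     (c (x + 1) y \<and> c x (y - 1) \<and> c x (y + 1) \<longrightarrow> c (x - 1) y))"

text \<open>The premise has the form in which saturation of a coloring is available: a neighbor is
  colored once the other three are.\<close>

lemma force_atI:
  assumes "\<And>x' y'. c x y \<Longrightarrow> (x', y') \<in> {(x + 1, y), (x - 1, y), (x, y + 1), (x, y - 1)} \<Longrightarrow>
      (\<And>x'' y''. (x'', y'') \<in> {(x + 1, y), (x - 1, y), (x, y + 1), (x, y - 1)} \<Longrightarrow>
        (x'', y'') \<noteq> (x', y') \<Longrightarrow> c x'' y'') \<Longrightarrow> c x' y'"
  shows "force_at c x y"
  using assms[of x "y + 1"] assms[of x "y - 1"] assms[of "x + 1" y] assms[of "x - 1" y]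
  unfolding force_at_def insert_iff empty_iff prod.inject by (smt (verit))

lemma force_right:
  assumes "force_at c (x - 1) y" "c (x - 1) y" "c (x - 2) y" "c (x - 1) (y - 1)" "c (x - 1) (y + 1)"
  shows "c x y"
  using assms unfolding force_at_def by simp

lemma force_left:
  assumes "force_at c (x + 1) y" "c (x + 1) y" "c (x + 2) y" "c (x + 1) (y - 1)" "c (x + 1) (y + 1)"
  shows "c x y"
  using assms unfolding force_at_def by (simp add: add.assoc)

text \<open>Up means towards smaller \<open>y\<close>; forcing towards larger \<open>y\<close> is
  reduced to this case by \<open>force_at_reflect_y\<close>.\<close>

lemma force_up:
  assumes "force_at c x (y + 1)" "c x (y + 1)" "c x (y + 2)" "c (x - 1) (y + 1)" "c (x + 1) (y + 1)"
  shows "c x y"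
  using assms unfolding force_at_def by (simp add: add.assoc)

text \<open>This and the two reflections carry a fill lemma stated to the right of column 0 to any
  column, to the left side, or upside down.\<close>

lemma force_at_shift: "force_at (\<lambda>x y. c (s + x) (t + y)) x y \<longleftrightarrow> force_at c (s + x) (t + y)"
  unfolding force_at_def by (simp add: algebra_simps)

lemma force_at_reflect_x: "force_at (\<lambda>x y. c (s - x) y) x y \<longleftrightarrow> force_at c (s - x) y"
  unfolding force_at_def by (auto simp: algebra_simps)

lemma force_at_reflect_y:
  "force_at (\<lambda>x y. c (s + x) (t - y)) x y \<longleftrightarrow> force_at c (s + x) (t - y)"
  unfolding force_at_def by (auto simp: algebra_simps)

section \<open>Filling one side by reflected fronts\<close>

text \<open>
  The cone \<open>x \<le> y\<close> is filled column by column; then diagonals \<open>x - y = const\<close> are filled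
  starting from the wall \<open>x = K\<close>, each point \<open>(x, y)\<close> being forced by \<open>(x, y + 1)\<close>.
\<close>

lemma cone_fill:
  assumes F: "\<And>x y. 1 \<le> x \<Longrightarrow> x \<le> K \<Longrightarrow> - Q \<le> y \<Longrightarrow> y \<le> P \<Longrightarrow> force_at c x y"
    and out: "\<And>x y. x > K \<or> y > P \<or> y < - Q \<Longrightarrow> c x y"
    and "K \<le> P"
    and base0: "\<And>y. - f \<le> y \<Longrightarrow> c 0 y"
    and base1: "\<And>y. 1 \<le> y \<Longrightarrow> c 1 y"
    and "0 \<le> f" "1 \<le> x" "- x - f \<le> y"
  shows "c x y"
proof -
  have low: "c x y" if "1 \<le> x" "x \<le> y" for x y
    using that
  proof (induction "nat x" arbitrary: x y rule: less_induct)
    case less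
    show ?case
    proof (cases "x = 1 \<or> x > K \<or> y > P \<or> y < - Q")
      case True
      then show ?thesis using base1 out less.prems by auto
    next
      case False
      have IH: "c x' y'" if "0 \<le> x'" "x' < x" "x' \<le> y'" for x' y'
        using that less.hyps[of x' y'] base0[of y'] \<open>0 \<le> f\<close> by (cases "x' = 0") auto
      show ?thesis
        by (rule force_right) (use False less.prems in \<open>auto intro!: F IH\<close>)
    qed
  qed
  show ?thesis
    using assms(7,8)
  \<comment> \<open>Lexicographic order on \<open>(x - y, K - x)\<close> packed into one number:
    inside the grid \<open>x - y + P\<close> is nonnegative and \<open>K - x\<close> lies below the
    factor \<open>K + 1\<close>.\<close>
  proof (induction "nat ((x - y + P) * (K + 1) + (K - x))" arbitrary: x y rule: less_induct)
    case less
    show ?case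
    proof (cases "x \<le> y \<or> x > K \<or> y > P \<or> y < - Q")
      case True
      then show ?thesis using low out less.prems by auto
    next
      case False
      let ?r = "\<lambda>x y. (x - y + P) * (K + 1) + (K - x)"
      have IH: "c x' y'" if "0 \<le> x'" "x' \<le> x + 1" "x' - y' \<le> x - y"
          "x' - y' < x - y \<or> x < x'" "- x' - f \<le> y'" for x' y'
      proof (cases "x' = 0 \<or> x' > K \<or> y' > P")
        case True
        then show ?thesis using base0 out that by auto
      next
        case in_grid: False
        have "?r x' y' < ?r x y"
        proof (cases "x' - y' < x - y")
          case True
          then have "(x' - y' + P + 1) * (K + 1) \<le> (x - y + P) * (K + 1)"
            using False less.prems by (intro mult_right_mono) auto
          then show ?thesis
            using in_grid False that less.prems by (simp add: algebra_simps)
        next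
          case False
          then have "x' - y' = x - y" "x < x'" using that by auto
          then show ?thesis by simp
        qed
        moreover have "0 \<le> (x' - y' + P) * (K + 1)"
          using in_grid that by (intro mult_nonneg_nonneg) auto
        then have "0 \<le> ?r x' y'"
          using in_grid by simp
        ultimately have "nat (?r x' y') < nat (?r x y)"
          by linarith
        then show ?thesis
          using that in_grid by (intro less.hyps) auto
      qed
      show ?thesis
      proof (rule force_up)
        \<comment> \<open>Here \<open>y < x \<le> K \<le> P\<close>, so the forcing point is still
          in the grid.\<close>
        show "force_at c x (y + 1)"
          using False less.prems \<open>K \<le> P\<close> by (intro F) auto
      qed (use less.prems \<open>0 \<le> f\<close> in \<open>auto intro!: IH\<close>)
    qed
  qed
qed

text \<open>
  The antidiagonals \<open>x + y = const\<close> are filled from the corner \<open>x = K\<close>, \<open>y = - Q\<close> inwards.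
\<close>

lemma side_fill_from_cone:
  assumes F: "\<And>x y. 1 \<le> x \<Longrightarrow> x \<le> K \<Longrightarrow> - Q \<le> y \<Longrightarrow> y \<le> P \<Longrightarrow> force_at c x y"
    and out: "\<And>x y. x > K \<or> y > P \<or> y < - Q \<Longrightarrow> c x y"
    and cone: "\<And>x y. 0 \<le> x \<Longrightarrow> - x - f \<le> y \<Longrightarrow> c x y"
    and "Q \<le> K + f" "0 \<le> x"
  shows "c x y"
  using \<open>0 \<le> x\<close>
proof (induction "nat ((- x - f - y) * (K + 1) + (K - x))" arbitrary: x y rule: less_induct)
  case less
  show ?case
  proof (cases "- x - f \<le> y \<or> x > K \<or> y > P \<or> y < - Q")
    case True
    then show ?thesis using cone out less.prems by auto
  next
    case False
    let ?r = "\<lambda>x y. (- x - f - y) * (K + 1) + (K - x)"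
    have IH: "c x' y'" if "x < x'" "- x' - y' \<le> - x - y" for x' y'
    proof (cases "x' > K \<or> - x' - f \<le> y'")
      case True
      then show ?thesis using cone out that less.prems by auto
    next
      case in_grid: False
      have "(- x' - f - y') * (K + 1) \<le> (- x - f - y) * (K + 1)"
        using False that less.prems by (intro mult_right_mono) auto
      then have "?r x' y' < ?r x y"
        using that by linarith
      moreover have "0 \<le> (- x' - f - y') * (K + 1)"
        using in_grid that less.prems False assms(4) by (intro mult_nonneg_nonneg) auto
      then have "0 \<le> ?r x' y'"
        using in_grid by simp
      ultimately show ?thesis
        using that less.prems by (intro less.hyps) auto
    qed
    \<comment> \<open>A remaining point has \<open>- Q \<le> y < - x - f\<close>, so
      \<open>Q \<le> K + f\<close> gives \<open>x < K\<close>, and the forcing point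
      \<open>(x + 1, y)\<close> is in the grid.\<close>
    show ?thesis
      by (rule force_left) (use False less.prems assms(4) in \<open>auto intro!: F IH\<close>)
  qed
qed

text \<open>The cone meets the wall \<open>x = K\<close> in row \<open>- K - f\<close>. As
  \<open>Q \<le> K + f\<close>, it covers the corner, from which the second reflection
  starts.\<close>

lemma side_fill:
  assumes F: "\<And>x y. 1 \<le> x \<Longrightarrow> x \<le> K \<Longrightarrow> - Q \<le> y \<Longrightarrow> y \<le> P \<Longrightarrow> force_at c x y"
    and out: "\<And>x y. x > K \<or> y > P \<or> y < - Q \<Longrightarrow> c x y"
    and "K \<le> P"
    and base0: "\<And>y. - f \<le> y \<Longrightarrow> c 0 y"
    and base1: "\<And>y. 1 \<le> y \<Longrightarrow> c 1 y"
    and "0 \<le> f" "Q \<le> K + f" "0 \<le> x"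
  shows "c x y"
proof (rule side_fill_from_cone[where c = c and K = K and Q = Q and P = P and f = f])
  fix x y :: int
  assume "0 \<le> x" "- x - f \<le> y"
  then show "c x y"
    using base0 cone_fill[where c = c and K = K and Q = Q and P = P and f = f, of x y] assms(1-6)
    by (cases "x = 0") auto
qed (use assms in auto)

text \<open>
  With one row more than the cone can reach, the point \<open>(0, - 1)\<close> is forced as soon as \<open>(1, 0)\<close>
  is colored, and this widens the cone by the missing row.
\<close>

lemma side_fill_extra:
  assumes F: "\<And>x y. 1 \<le> x \<Longrightarrow> x \<le> K \<Longrightarrow> - Q \<le> y \<Longrightarrow> y \<le> P \<Longrightarrow> force_at c x y"
    and out: "\<And>x y. x > K \<or> y > P \<or> y < - Q \<Longrightarrow> c x y"
    and "K \<le> P"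
    and base0: "\<And>y. 0 \<le> y \<Longrightarrow> c 0 y"
    and base1: "\<And>y. 1 \<le> y \<Longrightarrow> c 1 y"
    and e: "Q \<le> K \<or> Q \<le> K + 1 \<and> c (- 1) 0 \<and> force_at c 0 0" and "0 \<le> x"
  shows "c x y"
proof (cases "Q \<le> K")
  case True
  show ?thesis
    by (rule side_fill[where c = c and K = K and Q = Q and P = P and f = 0]) (use assms True in auto)
next
  case False
  have c10: "c 1 0"
    by (rule cone_fill[where c = c and K = K and Q = Q and P = P and f = 0]) (use assms(1-5) in auto)
  have "c 0 (- 1)"
    by (rule force_up) (use e False c10 base0[of 0] base0[of 1] in auto)
  then have base0': "c 0 y" if "- 1 \<le> y" for y
    using that base0[of y] by (cases "y = - 1") auto
  show ?thesis
    by (rule side_fill[where c = c and K = K and Q = Q and P = P and f = 1])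
      (use assms(1-3,5-7) base0' False in auto)
qed

section \<open>Sweeping full columns and passing the leak\<close>

text \<open>Two adjacent full columns force the next one. Column \<open>r\<close> itself never has
  to force, so the leak may lie there.\<close>

lemma sweep_right:
  fixes l r :: int
  assumes full: "\<And>x y. x \<le> l \<Longrightarrow> c x y"
    and rows: "\<And>x y. y \<notin> Y \<Longrightarrow> x \<le> r \<Longrightarrow> c x y"
    and F: "\<And>x y. l \<le> x \<Longrightarrow> x < r \<Longrightarrow> y \<in> Y \<Longrightarrow> force_at c x y"
    and "x \<le> r"
  shows "c x y"
  using \<open>x \<le> r\<close>
proof (induction "nat (x - l)" arbitrary: x y rule: less_induct)
  case (less x y)
  show ?case
  proof (cases "x \<le> l \<or> y \<notin> Y")
    case True
    then show ?thesis using full rows less.prems by blast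
  next
    case False
    have IH: "c x' y'" if "x' < x" for x' y'
      using that less full[of x' y'] by (cases "x' \<le> l") auto
    show ?thesis
      by (rule force_right) (use False less.prems in \<open>auto intro!: F IH\<close>)
  qed
qed

lemma sweep_left:
  fixes l r :: int
  assumes full: "\<And>x y. r \<le> x \<Longrightarrow> c x y"
    and rows: "\<And>x y. y \<notin> Y \<Longrightarrow> l \<le> x \<Longrightarrow> c x y"
    and F: "\<And>x y. l < x \<Longrightarrow> x \<le> r \<Longrightarrow> y \<in> Y \<Longrightarrow> force_at c x y"
    and "l \<le> x"
  shows "c x y"
proof -
  have "c (0 - (- x)) y"
  proof (rule sweep_right[where c = "\<lambda>x y. c (0 - x) y" and l = "- r" and r = "- l" and Y = Y])
    fix x y :: int
    assume "- r \<le> x" "x < - l" "y \<in> Y"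
    then show "force_at (\<lambda>x y. c (0 - x) y) x y"
      unfolding force_at_reflect_x by (intro F) auto
  qed (use full rows \<open>l \<le> x\<close> in auto)
  then show ?thesis by simp
qed

text \<open>The leak withholds only \<open>(1, b)\<close> from column 1, so a cone with its origin
  at the leak can start in either vertical direction.\<close>

lemma fill_past_leak:
  assumes F: "\<And>x y. 0 \<le> x \<Longrightarrow> x \<le> K \<Longrightarrow> - Q \<le> y \<Longrightarrow> y \<le> P \<Longrightarrow> (x, y) \<noteq> (0, b) \<Longrightarrow> force_at c x y"
    and out: "\<And>x y. x > K \<or> y > P \<or> y < - Q \<Longrightarrow> c x y"
    and full: "\<And>x y. x \<le> 0 \<Longrightarrow> c x y"
    and "K \<le> P" "K \<le> Q"
  shows "c x y"
proof -
  have next_col: "c 1 y" if "y \<noteq> b" for y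
  proof (cases "1 > K \<or> y > P \<or> y < - Q")
    case False
    show ?thesis
      by (rule force_right) (use False that in \<open>auto intro!: F full\<close>)
  qed (use out in auto)
  have "c x y" if "0 \<le> x" for y
  \<comment> \<open>The cone is aimed at the wall at distance at least \<open>K\<close> from the
    leak: \<open>K \<le> P - b\<close> in the first case, \<open>K \<le> Q + b\<close> in the
    second.\<close>
  proof (cases "b \<le> 0")
    case True
    \<comment> \<open>Column 0 is full, so any \<open>f\<close> is available; the least one that
      reaches the corner is taken.\<close>
    have "c (0 + x) (b + (y - b))"
    proof (rule side_fill[where c = "\<lambda>x y. c (0 + x) (b + y)" and K = K and Q = "Q + b"
          and P = "P - b" and f = "max 0 (Q + b - K)"])
      fix x y :: int
      assume "1 \<le> x" "x \<le> K" "- (Q + b) \<le> y" "y \<le> P - b"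
      then show "force_at (\<lambda>x y. c (0 + x) (b + y)) x y"
        unfolding force_at_shift[of c 0] by (intro F) auto
    next
      show "c (0 + x) (b + y)" if "K < x \<or> P - b < y \<or> y < - (Q + b)" for x y
        using that by (intro out) auto
    qed (use True that full next_col \<open>K \<le> P\<close> in auto)
    then show ?thesis by simp
  next
    case False
    have "c (0 + x) (b - (b - y))"
    proof (rule side_fill[where c = "\<lambda>x y. c (0 + x) (b - y)" and K = K and Q = "P - b"
          and P = "Q + b" and f = "max 0 (P - b - K)"])
      fix x y :: int
      assume "1 \<le> x" "x \<le> K" "- (P - b) \<le> y" "y \<le> Q + b"
      then show "force_at (\<lambda>x y. c (0 + x) (b - y)) x y"
        unfolding force_at_reflect_y[of c 0 b] by (intro F) auto
    next
      show "c (0 + x) (b - y)" if "K < x \<or> Q + b < y \<or> y < - (P - b)" for x y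
        using that by (intro out) auto
    qed (use False that full next_col \<open>K \<le> Q\<close> in auto)
    then show ?thesis by simp
  qed
  then show ?thesis using full[of x y] by (cases "x \<le> 0") auto
qed


section \<open>Filling the whole grid around one leak\<close>

text \<open>
  The left end of the bar is the origin and rows are numbered downwards; \<open>(a, b)\<close> is the leak.
\<close>

lemma grid_fill:
  fixes W k q a b :: int
  assumes F: "\<And>x y. - k \<le> x \<Longrightarrow> x \<le> W + k \<Longrightarrow> - q \<le> y \<Longrightarrow> y \<le> k \<Longrightarrow> (x, y) \<noteq> (a, b) \<Longrightarrow>
      force_at c x y"
    and out: "\<And>x y. x < - k \<or> x > W + k \<or> y < - q \<or> y > k \<Longrightarrow> c x y"
    and bar: "\<And>x. 0 \<le> x \<Longrightarrow> x \<le> W \<Longrightarrow> c x 0"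
    and stem: "\<And>y. 1 \<le> y \<Longrightarrow> y \<le> k \<Longrightarrow> c 0 y \<and> c 1 y"
    and "0 \<le> W" "0 \<le> k" "k \<le> q" "q \<le> k + 1" "W = 0 \<Longrightarrow> q = k"
  shows "c x y"
proof -
  have stem0: "c 0 y" if "0 \<le> y" for y
    using that stem[of y] bar[of 0] out[of 0 y] \<open>0 \<le> W\<close> by (cases "y = 0"; cases "y > k") auto
  have stem1: "c 1 y" if "1 \<le> y" for y
    using that stem[of y] out[of 1 y] by (cases "y > k") auto
  \<comment> \<open>The first condition keeps the leak off the right side, with column 0 allowed if
    \<open>W = 0\<close>; the second keeps it off the block under the bar.\<close>
  have right: "c x y" if "a < W \<or> a \<le> 0" and no_leak: "a \<le> 0 \<or> b < 0" and "W \<le> x" for x y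
  proof -
    \<comment> \<open>Column \<open>W + 1\<close> is included because the side fill starts from two
      adjacent columns.\<close>
    have below: "c x y" if "1 \<le> x" "x \<le> W + 1" "1 \<le> y" for x y
      using that
    proof (induction "nat x" arbitrary: x y rule: less_induct)
      case (less x y)
      show ?case
      proof (cases "x = 1 \<or> x > W + k \<or> y > k")
        case True
        then show ?thesis using less.prems stem1 out by auto
      next
        case False
        have IH: "c x' y'" if "0 \<le> x'" "x' < x" "0 \<le> y'" for x' y'
          using that less stem0 bar by (cases "x' = 0"; cases "y' = 0") auto
        show ?thesis
          by (rule force_right) (use False less.prems no_leak assms(6,7) in \<open>auto intro!: F IH\<close>)
      qed
    qed
    have "c W y" if "0 \<le> y" for y
      using that below[of W y] stem0[of y] bar[of W] \<open>0 \<le> W\<close> by (cases "W = 0"; cases "y = 0") auto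
    then have base: "c W y" if "0 \<le> y" for y
      using that .
    have "c (W + (x - W)) (0 + y)"
    proof (rule side_fill_extra[where c = "\<lambda>x y. c (W + x) (0 + y)" and K = k and Q = q and P = k])
      fix x y :: int
      assume "1 \<le> x" "x \<le> k" "- q \<le> y" "y \<le> k"
      then show "force_at (\<lambda>x y. c (W + x) (0 + y)) x y"
        unfolding force_at_shift[of c W 0] using \<open>a < W \<or> a \<le> 0\<close> assms(5) by (intro F) auto
    next
      \<comment> \<open>If \<open>W = 0\<close>, the leak may be at \<open>(W, 0)\<close>; but then
        \<open>q = k\<close>, and this point need not force.\<close>
      show "q \<le> k \<or> q \<le> k + 1 \<and> c (W + - 1) (0 + 0) \<and> force_at (\<lambda>x y. c (W + x) (0 + y)) 0 0"
        unfolding force_at_shift[of c W 0] using \<open>a < W \<or> a \<le> 0\<close> assms(5-9) bar[of "W - 1"]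
        by (cases "W = 0") (auto intro!: F)
    next
      show "c (W + x) (0 + y)" if "k < x \<or> k < y \<or> y < - q" for x y
        using that by (intro out) auto
    qed (use assms(5-7) base below that in auto)
    then show ?thesis by simp
  qed
  show ?thesis
  proof (cases "a \<le> 0")
    case True
    \<comment> \<open>The sweep stops at the column of the leak, or at the left wall if
      \<open>(a, b)\<close> lies beyond it.\<close>
    have full: "c x y" if "a \<le> x" "- k \<le> x" for x y
      by (rule sweep_left[where c = c and r = W and l = "max a (- k)" and Y = "{- q..k}"])
        (use True right that assms(5,6) in \<open>auto intro!: F out\<close>)
    show ?thesis
    proof (cases "a < - k")
      case True
      then show ?thesis using full[of x y] out[of x y] by (cases "- k \<le> x") auto
    next
      case False
      have "c (a - (a - x)) y"
      proof (rule fill_past_leak[where c = "\<lambda>x y. c (a - x) y" and K = "a + k" and Q = q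
            and P = k and b = b])
        fix x y :: int
        assume "0 \<le> x" "x \<le> a + k" "- q \<le> y" "y \<le> k" "(x, y) \<noteq> (0, b)"
        then show "force_at (\<lambda>x y. c (a - x) y) x y"
          unfolding force_at_reflect_x[of c a] using True assms(5) by (intro F) auto
      next
        show "c (a - x) y" if "a + k < x \<or> k < y \<or> y < - q" for x y
          using that by (intro out) auto
      next
        show "c (a - x) y" if "x \<le> 0" for x y
          using that False by (intro full) auto
      qed (use True assms(7) in auto)
      then show ?thesis by simp
    qed
  next
    case pos: False
    \<comment> \<open>With \<open>a > 0\<close>, no column that forces on the left contains the
      leak; the stem starts that side by forcing column -1.\<close>
    have left1: "c (- 1) y" if "1 \<le> y" for y
    proof (cases "y > k")
      case False
      show ?thesis
        by (rule force_left) (use False pos that assms(5-7) in \<open>auto intro!: F stem0 stem1\<close>)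
    qed (use out in auto)
    have "c (0 - (0 - x)) y" if "x \<le> 0" for x y
    proof (rule side_fill_extra[where c = "\<lambda>x y. c (0 - x) y" and K = k and Q = q and P = k])
      fix x y :: int
      assume "1 \<le> x" "x \<le> k" "- q \<le> y" "y \<le> k"
      then show "force_at (\<lambda>x y. c (0 - x) y) x y"
        unfolding force_at_reflect_x[of c 0] using pos assms(5) by (intro F) auto
    next
      show "q \<le> k \<or> q \<le> k + 1 \<and> c (0 - - 1) 0 \<and> force_at (\<lambda>x y. c (0 - x) y) 0 0"
        unfolding force_at_reflect_x[of c 0] using pos assms(5-9) bar[of 1]
        by (cases "W = 0") (auto intro!: F)
    next
      show "c (0 - x) y" if "k < x \<or> k < y \<or> y < - q" for x y
        using that by (intro out) auto
    qed (use assms(5-7) stem0 left1 that in auto)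
    then have left: "c x y" if "x \<le> 0" for x y
      using that by simp
    have full: "c x y" if "x \<le> a" "x \<le> W + k" for x y
      by (rule sweep_right[where c = c and l = 0 and r = "min a (W + k)" and Y = "{- q..k}"])
        (use left pos that assms(6) in \<open>auto intro!: F out\<close>)
    show ?thesis
    proof (cases "W \<le> a")
      case True
      show ?thesis
      proof (cases "W + k < a")
        case True
        then show ?thesis using full[of x y] out[of x y] by (cases "x \<le> W + k") auto
      next
        case False
        have "c (a + (x - a)) (0 + y)"
        proof (rule fill_past_leak[where c = "\<lambda>x y. c (a + x) (0 + y)" and K = "W + k - a"
              and Q = q and P = k and b = b])
          fix x y :: int
          assume "0 \<le> x" "x \<le> W + k - a" "- q \<le> y" "y \<le> k" "(x, y) \<noteq> (0, b)"
          then show "force_at (\<lambda>x y. c (a + x) (0 + y)) x y"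
            unfolding force_at_shift[of c a 0] using pos assms(6) by (intro F) auto
        next
          show "c (a + x) (0 + y)" if "W + k - a < x \<or> k < y \<or> y < - q" for x y
            using that by (intro out) auto
        next
          show "c (a + x) (0 + y)" if "x \<le> 0" for x y
            using that False by (intro full) auto
        qed (use True assms(7) in auto)
        then show ?thesis by simp
      qed
    next
      \<comment> \<open>Now \<open>0 < a < W\<close>. The right side is filled from below if
        \<open>b < 0\<close> and from above otherwise; then the columns in between are swept
        leftwards to the leak.\<close>
      case mid: False
      have right: "c x y" if "W \<le> x" for x y
      proof (cases "b < 0")
        case True
        then show ?thesis using right that mid by auto
      next
        case False
        \<comment> \<open>Only points in rows \<open>y < 0\<close> force here, which a leak with
          \<open>b \<ge> 0\<close> cannot disturb.\<close>
        have above: "c x y" if "y \<le> 0" "x \<le> W + 1" "y < 0 \<or> x \<le> W" for x y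
          using that
        proof (induction "nat x" arbitrary: x y rule: less_induct)
          case (less x y)
          show ?case
          proof (cases "x \<le> a \<or> y = 0 \<or> y < - q \<or> x > W + k")
            case True
            then show ?thesis
              using less.prems full[of x y] bar[of x] out[of x y] pos mid assms(6)
              by (cases "x \<le> a") auto
          next
            case False
            have IH: "c x' y'" if "x' < x" "y' \<le> 0" for x' y'
              using that less.hyps[of x' y'] less.prems full[of x' y'] pos mid assms(6)
              by (cases "x' \<le> a") auto
            show ?thesis
              by (rule force_right)
                (use False less.prems pos \<open>\<not> b < 0\<close> assms(6) in \<open>auto intro!: F IH\<close>)
          qed
        qed
        \<comment> \<open>Upside down the target is the lower corner; \<open>k\<close> rows below
          the bar match \<open>k\<close> free columns, so \<open>f = 0\<close> suffices.\<close>
        have "c (W + (x - W)) (0 - (0 - y))"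
        proof (rule side_fill[where c = "\<lambda>x y. c (W + x) (0 - y)" and K = k and Q = k and P = q
              and f = 0])
          fix x y :: int
          assume "1 \<le> x" "x \<le> k" "- k \<le> y" "y \<le> q"
          then show "force_at (\<lambda>x y. c (W + x) (0 - y)) x y"
            unfolding force_at_reflect_y[of c W 0] using mid assms(5) by (intro F) auto
        next
          show "c (W + x) (0 - y)" if "k < x \<or> q < y \<or> y < - k" for x y
            using that by (intro out) auto
        qed (use that assms(7) above in auto)
        then show ?thesis by simp
      qed
      have "c x y" if "a \<le> x" for x y
        by (rule sweep_left[where c = c and r = W and l = a and Y = "{- q..k}"])
          (use pos mid right that assms(5,6) in \<open>auto intro!: F out\<close>)
      then show ?thesis
        using full[of x y] mid assms(6) by (cases "x \<le> a") auto
    qed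
  qed
qed

section \<open>Saturated colorings, the forcing set and its size\<close>

text \<open>A reachable coloring of maximal size works: a vertex outside \<open>L\<close> has no
  pendant neighbor, so a violation would permit one more color change.\<close>

lemma saturated_coloring:
  assumes G: "pair_graph G" and "L \<subseteq> pverts G" "S \<subseteq> pverts G"
  obtains B where "(color_change (add_leaks G L))\<^sup>*\<^sup>* (Inl ` S) B" "Inl ` S \<subseteq> B"
    "\<And>u w. Inl u \<in> B \<Longrightarrow> u \<notin> L \<Longrightarrow> (u, w) \<in> parcs G \<Longrightarrow>
      (\<And>v. (u, v) \<in> parcs G \<Longrightarrow> v \<noteq> w \<Longrightarrow> Inl v \<in> B) \<Longrightarrow> Inl w \<in> B"
proof -
  let ?H = "add_leaks G L"
  let ?R = "(color_change ?H)\<^sup>*\<^sup>* (Inl ` S)"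
  interpret H: pair_graph ?H
    using pair_graph_add_leaks assms by blast
  have bound: "Inl ` S \<subseteq> B \<and> B \<subseteq> pverts ?H" if "?R B" for B
    using that
  proof induction
    case base
    then show ?case using assms(3) by (auto simp: add_leaks_def)
  next
    case (step B B')
    then obtain u w where w: "{v. (u, v) \<in> parcs ?H \<and> v \<notin> B} = {w}" and B': "B' = insert w B"
      unfolding color_change_def by blast
    from w have "(u, w) \<in> parcs ?H" by auto
    then have "w \<in> pverts ?H" by (rule H.in_arcsD2)
    then show ?case using step.IH B' by auto
  qed
  have card_bound: "card B \<le> card (pverts ?H)" if "?R B" for B
    using bound[OF that] by (simp add: card_mono)
  have "\<exists>B. ?R B \<and> (\<forall>B'. ?R B' \<longrightarrow> card B' \<le> card B)"
    by (rule ex_has_greatest_nat[where b = "Suc (card (pverts ?H))"])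
      (use card_bound in \<open>auto simp: less_Suc_eq_le\<close>)
  then obtain B where B: "?R B" and maximal: "\<And>B'. ?R B' \<Longrightarrow> card B' \<le> card B"
    by auto
  show ?thesis
  proof (rule that[OF B])
    show "Inl ` S \<subseteq> B" using bound[OF B] by simp
  next
    fix u w
    assume *: "Inl u \<in> B" "u \<notin> L" "(u, w) \<in> parcs G"
      "\<And>v. (u, v) \<in> parcs G \<Longrightarrow> v \<noteq> w \<Longrightarrow> Inl v \<in> B"
    show "Inl w \<in> B"
    proof (rule ccontr)
      assume w: "Inl w \<notin> B"
      then have "{v. (Inl u, v) \<in> parcs ?H \<and> v \<notin> B} = {Inl w}"
        using * by (auto simp: add_leaks_def)
      then have "color_change ?H B (insert (Inl w) B)"
        unfolding color_change_def using *(1) by (intro bexI[of _ "Inl u"] exI[of _ "Inl w"]) auto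
      then have "?R (insert (Inl w) B)"
        using B by (rule rtranclp.rtrancl_into_rtrancl[rotated])
      then have "card (insert (Inl w) B) \<le> card B"
        by (rule maximal)
      moreover have "finite B"
        using bound[OF B] finite_subset H.pair_finite_verts by blast
      ultimately show False using w by simp
    qed
  qed
qed

lemma leaky_forcing_number_le:
  assumes "leaky_forcing_set l G S"
  shows "leaky_forcing_number l G \<le> card S"
  unfolding leaky_forcing_number_def using assms by (intro Least_le) blast

lemma grid_arc_iff:
  "((i, j), (i', j')) \<in> parcs (path_graph n \<box> path_graph m) \<longleftrightarrow>
    {i, i'} \<subseteq> {1..n} \<and> {j, j'} \<subseteq> {1..m} \<and>
    (i = i' \<and> (j' = j + 1 \<or> j = j' + 1) \<or> j = j' \<and> (i' = i + 1 \<or> i = i' + 1))"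
  by (auto simp: cartesian_product_def path_graph_def)

text \<open>There are \<open>q\<close> rows above the bar, \<open>k\<close> below it and
  \<open>k\<close> free columns on either side. A saturated coloring, read in coordinates with
  origin at the left end of the bar, satisfies the conditions of \<open>grid_fill\<close>.\<close>

lemma leaky_forcing_set_grid:
  fixes k q W :: nat
  assumes "k \<le> q" "q \<le> k + 1" "W = 0 \<Longrightarrow> q = k"
  shows "leaky_forcing_set 1 (path_graph (q + k + 1) \<box> path_graph (W + 2 * k + 1))
    ({q + 1} \<times> {k + 1..k + 1 + W} \<union> {q + 2..q + k + 1} \<times> {k + 1, k + 2})"
    (is "leaky_forcing_set 1 ?G ?S")
  unfolding leaky_forcing_set_def
proof (intro conjI allI impI)
  have verts: "pverts ?G = {1..q + k + 1} \<times> {1..W + 2 * k + 1}"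
    by (simp add: cartesian_product_def path_graph_def)
  show S: "?S \<subseteq> pverts ?G"
    unfolding verts by auto
  fix L
  assume L: "L \<subseteq> pverts ?G \<and> card L \<le> 1"
  have "finite L"
    using L finite_subset[of L "pverts ?G"] unfolding verts by blast
  \<comment> \<open>If \<open>L\<close> is empty, \<open>v\<close> is arbitrary and may lie outside
    the grid.\<close>
  then obtain v where v: "L \<subseteq> {v}"
    using L by (metis card_le_Suc0_iff_eq One_nat_def insertCI subsetI)
  have G: "pair_graph ?G"
    by (intro pair_graph_cartesian_product pair_graph_path_graph)
  obtain B where B: "(color_change (add_leaks ?G L))\<^sup>*\<^sup>* (Inl ` ?S) B" "Inl ` ?S \<subseteq> B"
    and saturated: "\<And>u w. Inl u \<in> B \<Longrightarrow> u \<notin> L \<Longrightarrow> (u, w) \<in> parcs ?G \<Longrightarrow>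
      (\<And>v. (u, v) \<in> parcs ?G \<Longrightarrow> v \<noteq> w \<Longrightarrow> Inl v \<in> B) \<Longrightarrow> Inl w \<in> B"
    using saturated_coloring[OF G _ S, of L] L by metis
  have S_B: "Inl u \<in> B" if "u \<in> ?S" for u
    using B(2) imageI[OF that] by (rule subsetD)
  define inside where "inside x y \<longleftrightarrow> - int k \<le> x \<and> x \<le> int (W + k) \<and> - int q \<le> y \<and> y \<le> int k"
    for x y
  \<comment> \<open>The coordinates are swapped: the first component of a grid vertex is its
    row.\<close>
  define pt where "pt x y = (nat (y + int q + 1), nat (x + int k + 1))" for x y
  define c where "c x y \<longleftrightarrow> (inside x y \<longrightarrow> Inl (pt x y) \<in> B)" for x y
  have arc: "(pt x y, v) \<in> parcs ?G \<longleftrightarrow>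
      (\<exists>x' y'. (x', y') \<in> {(x + 1, y), (x - 1, y), (x, y + 1), (x, y - 1)} \<and> inside x' y' \<and> v = pt x' y')"
    if "inside x y" for x y v
  proof
    assume arc: "(pt x y, v) \<in> parcs ?G"
    obtain i j where v: "v = (i, j)" by fastforce
    have "v = pt (int j - int k - 1) (int i - int q - 1)"
      unfolding v pt_def by simp
    moreover have "inside (int j - int k - 1) (int i - int q - 1)"
      using arc unfolding v pt_def grid_arc_iff inside_def by auto
    moreover have "(int j - int k - 1, int i - int q - 1) \<in>
        {(x + 1, y), (x - 1, y), (x, y + 1), (x, y - 1)}"
    proof -
      define I J where "I = nat (y + int q + 1)" and "J = nat (x + int k + 1)"
      then have "y = int I - int q - 1" "x = int J - int k - 1"
        using that unfolding inside_def by auto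
      moreover have "I = i \<and> (j = J + 1 \<or> J = j + 1) \<or> J = j \<and> (i = I + 1 \<or> I = i + 1)"
        using arc unfolding v pt_def I_def[symmetric] J_def[symmetric] grid_arc_iff by blast
      ultimately show ?thesis by auto
    qed
    ultimately show "\<exists>x' y'. (x', y') \<in> {(x + 1, y), (x - 1, y), (x, y + 1), (x, y - 1)} \<and>
        inside x' y' \<and> v = pt x' y'"
      by blast
  next
    assume "\<exists>x' y'. (x', y') \<in> {(x + 1, y), (x - 1, y), (x, y + 1), (x, y - 1)} \<and>
        inside x' y' \<and> v = pt x' y'"
    then obtain x' y' where near: "(x', y') \<in> {(x + 1, y), (x - 1, y), (x, y + 1), (x, y - 1)}"
      and "inside x' y'" and v: "v = pt x' y'" by blast
    define I J I' J' where "I = nat (y + int q + 1)" and "J = nat (x + int k + 1)"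
      and "I' = nat (y' + int q + 1)" and "J' = nat (x' + int k + 1)"
    then have "int I = y + int q + 1" "int J = x + int k + 1"
      "int I' = y' + int q + 1" "int J' = x' + int k + 1"
      using that \<open>inside x' y'\<close> unfolding inside_def by auto
    then have "I = I' \<and> (J' = J + 1 \<or> J = J' + 1) \<or> J = J' \<and> (I' = I + 1 \<or> I = I' + 1)"
      and "I \<in> {1..q + k + 1}" "I' \<in> {1..q + k + 1}"
      and "J \<in> {1..W + 2 * k + 1}" "J' \<in> {1..W + 2 * k + 1}"
      using that \<open>inside x' y'\<close> near unfolding inside_def by auto
    then show "(pt x y, v) \<in> parcs ?G"
      unfolding v pt_def grid_arc_iff I_def J_def I'_def J'_def by blast
  qed
  have force: "force_at c x y" if "inside x y" "pt x y \<noteq> v" for x y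
  proof (rule force_atI)
    let ?N = "{(x + 1, y), (x - 1, y), (x, y + 1), (x, y - 1)}"
    fix x' y'
    assume *: "c x y" "(x', y') \<in> ?N"
      "\<And>x'' y''. (x'', y'') \<in> ?N \<Longrightarrow> (x'', y'') \<noteq> (x', y') \<Longrightarrow> c x'' y''"
    show "c x' y'"
      unfolding c_def
    proof
      assume "inside x' y'"
      show "Inl (pt x' y') \<in> B"
      proof (rule saturated[of "pt x y"])
        show "Inl (pt x y) \<in> B" using *(1) \<open>inside x y\<close> unfolding c_def by simp
        show "pt x y \<notin> L" using v \<open>pt x y \<noteq> v\<close> by auto
        show "(pt x y, pt x' y') \<in> parcs ?G"
          using *(2) arc \<open>inside x y\<close> \<open>inside x' y'\<close> by blast
        show "Inl v \<in> B" if "(pt x y, v) \<in> parcs ?G" "v \<noteq> pt x' y'" for v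
          using that *(3) \<open>inside x y\<close> unfolding arc[OF \<open>inside x y\<close>] c_def by blast
      qed
    qed
  qed
  have "c x y" for x y
  proof (rule grid_fill[where c = c and k = "int k" and W = "int W" and q = "int q"
        and a = "int (snd v) - int k - 1" and b = "int (fst v) - int q - 1"])
    fix x y
    assume "- int k \<le> x" "x \<le> int W + int k" "- int q \<le> y" "y \<le> int k"
      "(x, y) \<noteq> (int (snd v) - int k - 1, int (fst v) - int q - 1)"
    then show "force_at c x y"
      by (intro force) (auto simp: inside_def pt_def)
  next
    show "c x 0" if "0 \<le> x" "x \<le> int W" for x
    proof -
      have "pt x 0 \<in> ?S" using that unfolding pt_def by auto
      then show ?thesis unfolding c_def by (intro impI S_B)
    qed
  next
    show "c 0 y \<and> c 1 y" if "1 \<le> y" "y \<le> int k" for y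
    proof -
      have "pt 0 y \<in> ?S" "pt 1 y \<in> ?S" using that unfolding pt_def by auto
      then show ?thesis unfolding c_def by (intro conjI impI S_B)
    qed
  qed (use assms in \<open>auto simp: c_def inside_def\<close>)
  then have all: "Inl (pt x y) \<in> B" if "inside x y" for x y
    using that unfolding c_def by blast
  have "Inl (i, j) \<in> B" if "(i, j) \<in> pverts ?G" for i j
    using all[of "int j - int k - 1" "int i - int q - 1"] that unfolding verts
    by (auto simp: inside_def pt_def)
  then show "\<exists>B. (color_change (add_leaks ?G L))\<^sup>*\<^sup>* (Inl ` ?S) B \<and> Inl ` pverts ?G \<subseteq> B"
    using B(1) by auto
qed

theorem theorem36:
  fixes n m :: nat
  assumes "n > 0" and "m > 0"
    and "n \<le> m" and "m \<le> n + 5"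
    and "m \<ge> 7"
  shows "leaky_forcing_number 1 (path_graph n \<box> path_graph m) \<le> m"
proof -
  \<comment> \<open>The \<open>n - 1\<close> rows off the bar are split evenly, an odd one going
    above. As \<open>2 * k < n \<le> m\<close>, the subtraction in \<open>W\<close> is exact, and
    \<open>W = 0\<close> forces \<open>n = m\<close> odd, hence \<open>q = k\<close>.\<close>
  define k q W where "k = (n - 1) div 2" "q = n div 2" "W = m - 1 - 2 * k"
  have eq: "n = q + k + 1" "m = W + 2 * k + 1"
    using assms(1,3) unfolding k_q_W_def by linarith+
  let ?S = "{q + 1} \<times> {k + 1..k + 1 + W} \<union> {q + 2..q + k + 1} \<times> {k + 1, k + 2}"
  have "leaky_forcing_set 1 (path_graph n \<box> path_graph m) ?S"
    unfolding eq using assms(1,3) by (intro leaky_forcing_set_grid) (auto simp: k_q_W_def)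
  then have "leaky_forcing_number 1 (path_graph n \<box> path_graph m) \<le> card ?S"
    by (rule leaky_forcing_number_le)
  \<comment> \<open>The bar has \<open>W + 1\<close> points and the stem \<open>2 * k\<close>,
    together \<open>m\<close>.\<close>
  also have "\<dots> \<le> (W + 1) + k * 2"
    by (rule order.trans[OF card_Un_le]) (simp add: card_cartesian_product)
  finally show ?thesis using eq by simp
qed

end
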